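(* Consider the reversible nearest-neighbour PCA described in the context. For every $\eta\in\mathcal{X}\setminus\{\underline{-1},\underline{c}^e,\underline{c}^o,\underline{+1}\}$ there exists $V^*$ such that $V_\eta\le V^*<\Gamma^{\mathrm{PCA}}$.
   Context: Let $L$ be even, $\Lambda=\{0,\dots,L-1\}^2$ the two-dimensional torus (periodic boundary conditions, Euclidean metric), $\mathcal{X}=\{-1,+1\}^\Lambda$, and let $h\in(0,1)$ be fixed and small (external magnetic field). Put $S_\sigma(i)=\sum_{j\in\Lambda:|i-j|=1}\sigma(j)$. For $\beta>0$ the reversible Probabilistic Cellular Automaton (PCA) is the Markov chain on $\mathcal{X}$ with transition probabilities $p(\sigma,\eta)=\prod_{i\in\Lambda}p_{i,\sigma}(\eta(i))$, where $p_{i,\sigma}(a)=\frac1{1+\exp\{-2\beta a(S_\sigma(i)+h)\}}$, $a\in\{-1,+1\}$. The virtual energy is $H(\sigma)=-h\sum_{i\in\Lambda}\sigma(i)-\sum_{i\in\Lambda}|S_\sigma(i)+h|$, and the energy cost is $\Delta(\sigma,\eta)=-\lim_{\beta\to\infty}\frac{\log p(\sigma,\eta)}{\beta}=\sum_{i\in\Lambda:\,\eta(i)(S_\sigma(i)+h)<0}2|S_\sigma(i)+h|$. The transition energy is $H(\sigma,\eta):=H(\sigma)+\Delta(\sigma,\eta)$. A path is a finite sequence $\omega=(\omega_1,\dots,\omega_n)$ of configurations; its height is $\Phi_\omega=H(\omega_1)$ if $|\omega|=1$ and $\Phi_\omega=\max_{i<|\omega|}H(\omega_i,\omega_{i+1})$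 if $|\omega|>1$. $\Phi(\sigma,\eta)$ is the minimum of $\Phi_\omega$ over all paths from $\sigma$ to $\eta$, and $\Phi(A,B):=\min_{\sigma\in A,\eta\in B}\Phi(\sigma,\eta)$. With $\mathcal{I}_\sigma:=\{\eta\mid H(\eta)<H(\sigma)\}$, the stability level is $V_\sigma:=\Phi(\sigma,\mathcal{I}_\sigma)-H(\sigma)$ ($=\infty$ if $\mathcal{I}_\sigma=\emptyset$). $\underline{+1}$ and $\underline{-1}$ are the constant configurations; $\underline{c}^e(i)=(-1)^{i_1+i_2}$ and $\underline{c}^o(i)=(-1)^{i_1+i_2+1}$ for $i=(i_1,i_2)\in\Lambda$ are the chessboard configurations (either is written $\underline{c}$). The critical length is $\lambda:=[2/h]+1$, $[\cdot]$ being the integer part, and $\Gamma^{\mathrm{PCA}}:=-2h\lambda^2+2\lambda(4+h)-2h$. *)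

theory Defs
  imports "HOL-Analysis.Analysis"
begin

type_synonym site = "nat \<times> nat"
type_synonym config = "site \<Rightarrow> int"

definition torus :: "nat \<Rightarrow> site set" where
  "torus L = {0..<L} \<times> {0..<L}"

definition circ_dist :: "nat \<Rightarrow> nat \<Rightarrow> nat \<Rightarrow> real" where
  "circ_dist L a b = min \<bar>real a - real b\<bar> (real L - \<bar>real a - real b\<bar>)"

definition torus_dist :: "nat \<Rightarrow> site \<Rightarrow> site \<Rightarrow> real" where
  "torus_dist L i j =
     sqrt ((circ_dist L (fst i) (fst j))\<^sup>2 + (circ_dist L (snd i) (snd j))\<^sup>2)"

text \<open>Configurations are extensional functions, so that equality of configurations is equality
  on the torus and the configuration space is finite.\<close>

definition configs :: "nat \<Rightarrow> config set" where
  "configs L = torus L \<rightarrow>\<^sub>E {-1, 1}"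

definition plus_conf :: "nat \<Rightarrow> config" where
  "plus_conf L = (\<lambda>i\<in>torus L. 1)"

definition minus_conf :: "nat \<Rightarrow> config" where
  "minus_conf L = (\<lambda>i\<in>torus L. -1)"

definition chess_even :: "nat \<Rightarrow> config" where
  "chess_even L = (\<lambda>i\<in>torus L. (-1) ^ (fst i + snd i))"

definition chess_odd :: "nat \<Rightarrow> config" where
  "chess_odd L = (\<lambda>i\<in>torus L. (-1) ^ (fst i + snd i + 1))"

definition nbr_sum :: "nat \<Rightarrow> config \<Rightarrow> site \<Rightarrow> real" where
  "nbr_sum L \<sigma> i = (\<Sum>j\<in>{j \<in> torus L. torus_dist L i j = 1}. real_of_int (\<sigma> j))"

definition site_prob :: "nat \<Rightarrow> real \<Rightarrow> real \<Rightarrow> config \<Rightarrow> site \<Rightarrow> int \<Rightarrow> real" where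
  "site_prob L h \<beta> \<sigma> i a =
     1 / (1 + exp (- 2 * \<beta> * real_of_int a * (nbr_sum L \<sigma> i + h)))"

definition trans_prob :: "nat \<Rightarrow> real \<Rightarrow> real \<Rightarrow> config \<Rightarrow> config \<Rightarrow> real" where
  "trans_prob L h \<beta> \<sigma> \<eta> = (\<Prod>i\<in>torus L. site_prob L h \<beta> \<sigma> i (\<eta> i))"

definition energy :: "nat \<Rightarrow> real \<Rightarrow> config \<Rightarrow> real" where
  "energy L h \<sigma> =
     - h * (\<Sum>i\<in>torus L. real_of_int (\<sigma> i)) - (\<Sum>i\<in>torus L. \<bar>nbr_sum L \<sigma> i + h\<bar>)"

definition energy_cost :: "nat \<Rightarrow> real \<Rightarrow> config \<Rightarrow> config \<Rightarrow> real" where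
  "energy_cost L h \<sigma> \<eta> = - Lim at_top (\<lambda>\<beta>. ln (trans_prob L h \<beta> \<sigma> \<eta>) / \<beta>)"

definition trans_energy :: "nat \<Rightarrow> real \<Rightarrow> config \<Rightarrow> config \<Rightarrow> real" where
  "trans_energy L h \<sigma> \<eta> = energy L h \<sigma> + energy_cost L h \<sigma> \<eta>"

definition paths :: "nat \<Rightarrow> config \<Rightarrow> config \<Rightarrow> config list set" where
  "paths L \<sigma> \<eta> =
     {\<omega>. \<omega> \<noteq> [] \<and> set \<omega> \<subseteq> configs L \<and> hd \<omega> = \<sigma> \<and> last \<omega> = \<eta>}"

definition path_height :: "nat \<Rightarrow> real \<Rightarrow> config list \<Rightarrow> real" where
  "path_height L h \<omega> =
     (if length \<omega> = 1 then energy L h (hd \<omega>)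
      else Max ((\<lambda>k. trans_energy L h (\<omega> ! k) (\<omega> ! Suc k)) ` {k. Suc k < length \<omega>}))"

text \<open>There are infinitely many paths between two configurations, but their heights take only
  finitely many values (see \<open>finite_path_heights\<close> below), so the minimum is well defined.\<close>

definition comm_height :: "nat \<Rightarrow> real \<Rightarrow> config \<Rightarrow> config \<Rightarrow> real" where
  "comm_height L h \<sigma> \<eta> = Min (path_height L h ` paths L \<sigma> \<eta>)"

definition comm_height_sets :: "nat \<Rightarrow> real \<Rightarrow> config set \<Rightarrow> config set \<Rightarrow> real" where
  "comm_height_sets L h A B = Min ((\<lambda>(\<sigma>, \<eta>). comm_height L h \<sigma> \<eta>) ` (A \<times> B))"

definition lower_configs :: "nat \<Rightarrow> real \<Rightarrow> config \<Rightarrow> config set" where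
  "lower_configs L h \<sigma> = {\<eta> \<in> configs L. energy L h \<eta> < energy L h \<sigma>}"

definition stability_level :: "nat \<Rightarrow> real \<Rightarrow> config \<Rightarrow> ereal" where
  "stability_level L h \<sigma> =
     (if lower_configs L h \<sigma> = {} then \<infinity>
      else ereal (comm_height_sets L h {\<sigma>} (lower_configs L h \<sigma>) - energy L h \<sigma>))"

definition crit_length :: "real \<Rightarrow> int" where
  "crit_length h = \<lfloor>2 / h\<rfloor> + 1"

definition Gamma_PCA :: "real \<Rightarrow> real" where
  "Gamma_PCA h =
     - 2 * h * (real_of_int (crit_length h))\<^sup>2 + 2 * real_of_int (crit_length h) * (4 + h) - 2 * h"

lemma finite_torus: "finite (torus L)"
  by (simp add: torus_def)

lemma finite_configs: "finite (configs L)"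
  by (simp add: configs_def finite_torus finite_PiE)

lemma finite_lower_configs: "finite (lower_configs L h \<sigma>)"
  using finite_configs by (simp add: lower_configs_def)

lemma finite_path_heights: "finite (path_height L h ` paths L \<sigma> \<eta>)"
proof (rule finite_subset)
  let ?E = "energy L h ` configs L"
  let ?T = "(\<lambda>(a, b). trans_energy L h a b) ` (configs L \<times> configs L)"
  show "finite (?E \<union> ?T)"
    using finite_configs by blast
  show "path_height L h ` paths L \<sigma> \<eta> \<subseteq> ?E \<union> ?T"
  proof clarify
    fix \<omega> assume \<omega>: "\<omega> \<in> paths L \<sigma> \<eta>" and nT: "path_height L h \<omega> \<notin> ?T"
    have ne: "\<omega> \<noteq> []" and sub: "set \<omega> \<subseteq> configs L"
      using \<omega> by (auto simp: paths_def)
    show "path_height L h \<omega> \<in> ?E"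
    proof (cases "length \<omega> = 1")
      case True
      then show ?thesis
        using subsetD[OF sub hd_in_set[OF ne]] by (simp add: path_height_def)
    next
      case False
      let ?K = "{k. Suc k < length \<omega>}"
      have fin: "finite ?K"
        by (rule finite_subset[of _ "{..<length \<omega>}"]) auto
      have "0 \<in> ?K"
        using ne False by (cases \<omega>) auto
      then have "path_height L h \<omega> \<in> (\<lambda>k. trans_energy L h (\<omega> ! k) (\<omega> ! Suc k)) ` ?K"
        unfolding path_height_def using False fin by (simp, intro Max_in) auto
      then obtain k where k: "Suc k < length \<omega>"
        and eq: "path_height L h \<omega> = trans_energy L h (\<omega> ! k) (\<omega> ! Suc k)"
        by auto
      have "\<omega> ! k \<in> configs L" "\<omega> ! Suc k \<in> configs L"
        using k sub by (auto simp: subset_iff)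
      then show ?thesis
        using eq nT by (auto simp: image_iff)
    qed
  qed
qed

lemma paths_nonempty: "\<sigma> \<in> configs L \<Longrightarrow> \<eta> \<in> configs L \<Longrightarrow> paths L \<sigma> \<eta> \<noteq> {}"
  unfolding paths_def by (auto intro!: exI[of _ "[\<sigma>, \<eta>]"])

lemma ln_one_plus_exp_over_tendsto:
  fixes x :: real
  shows "((\<lambda>\<beta>. ln (1 + exp (\<beta> * x)) / \<beta>) \<longlongrightarrow> max 0 x) at_top"
proof (rule tendsto_sandwich)
  show "\<forall>\<^sub>F \<beta> in at_top. max 0 x \<le> ln (1 + exp (\<beta> * x)) / \<beta>"
    using eventually_gt_at_top[of "0::real"]
  proof eventually_elim
    case (elim \<beta>)
    have "ln (exp (\<beta> * x)) \<le> ln (1 + exp (\<beta> * x))" "0 \<le> ln (1 + exp (\<beta> * x))"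
      by (subst ln_le_cancel_iff) (auto simp: add_pos_pos intro: ln_ge_zero)
    then show ?case
      using elim by (auto simp: max_def field_simps)
  qed
  show "\<forall>\<^sub>F \<beta> in at_top. ln (1 + exp (\<beta> * x)) / \<beta> \<le> max 0 x + ln 2 / \<beta>"
    using eventually_gt_at_top[of "0::real"]
  proof eventually_elim
    case (elim \<beta>)
    have "1 \<le> exp (\<beta> * max 0 x)" "exp (\<beta> * x) \<le> exp (\<beta> * max 0 x)"
      using elim by auto
    then have "1 + exp (\<beta> * x) \<le> 2 * exp (\<beta> * max 0 x)"
      by linarith
    then have "ln (1 + exp (\<beta> * x)) \<le> ln (2 * exp (\<beta> * max 0 x))"
      by (subst ln_le_cancel_iff) (auto simp: add_pos_pos)
    also have "\<dots> = ln 2 + \<beta> * max 0 x"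
      by (simp add: ln_mult)
    finally show ?case
      using elim by (simp add: field_simps)
  qed
  have "((\<lambda>\<beta>. ln 2 / \<beta>) \<longlongrightarrow> (0::real)) at_top"
    by (rule tendsto_divide_0[OF tendsto_const filterlim_at_top_imp_at_infinity[OF filterlim_ident]])
  then show "((\<lambda>\<beta>. max 0 x + ln 2 / \<beta>) \<longlongrightarrow> max 0 x) at_top"
    using tendsto_add[OF tendsto_const, of _ "0::real" at_top "max 0 x"] by simp
qed simp

text \<open>The limit defining the energy cost exists; its closed form is a sum over the sites that are
  updated against the local field.\<close>

lemma energy_cost_tendsto:
  assumes "\<eta> \<in> configs L"
  shows "((\<lambda>\<beta>. ln (trans_prob L h \<beta> \<sigma> \<eta>) / \<beta>) \<longlongrightarrow>
     - (\<Sum>i\<in>{i \<in> torus L. real_of_int (\<eta> i) * (nbr_sum L \<sigma> i + h) < 0}.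
          2 * \<bar>nbr_sum L \<sigma> i + h\<bar>)) at_top"
proof -
  let ?x = "\<lambda>i. - 2 * real_of_int (\<eta> i) * (nbr_sum L \<sigma> i + h)"
  have eq: "ln (trans_prob L h \<beta> \<sigma> \<eta>) / \<beta> =
      - (\<Sum>i\<in>torus L. ln (1 + exp (\<beta> * ?x i)) / \<beta>)" for \<beta>
  proof -
    have pos: "0 < 1 + exp (\<beta> * ?x i)" for i
      by (simp add: add_pos_pos)
    have "trans_prob L h \<beta> \<sigma> \<eta> = (\<Prod>i\<in>torus L. 1 / (1 + exp (\<beta> * ?x i)))"
      by (simp add: trans_prob_def site_prob_def mult_ac)
    also have "ln \<dots> = (\<Sum>i\<in>torus L. ln (1 / (1 + exp (\<beta> * ?x i))))"
    proof (rule ln_prod[OF finite_torus])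
      fix i
      show "1 / (1 + exp (\<beta> * ?x i)) \<noteq> 0"
        by (rule less_imp_neq[symmetric], rule divide_pos_pos[OF zero_less_one pos])
    qed
    also have "\<dots> = (\<Sum>i\<in>torus L. - ln (1 + exp (\<beta> * ?x i)))"
    proof (rule sum.cong[OF refl])
      fix i
      show "ln (1 / (1 + exp (\<beta> * ?x i))) = - ln (1 + exp (\<beta> * ?x i))"
        using ln_inverse[of "1 + exp (\<beta> * ?x i)"] by (simp only: inverse_eq_divide)
    qed
    finally show ?thesis
      by (simp only: sum_negf sum_divide_distrib[symmetric] minus_divide_left)
  qed
  have spin: "\<eta> i = -1 \<or> \<eta> i = 1" if "i \<in> torus L" for i
    using assms that by (auto simp: configs_def)
  have "(\<Sum>i\<in>{i \<in> torus L. real_of_int (\<eta> i) * (nbr_sum L \<sigma> i + h) < 0}.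
          2 * \<bar>nbr_sum L \<sigma> i + h\<bar>) =
      (\<Sum>i\<in>torus L. if real_of_int (\<eta> i) * (nbr_sum L \<sigma> i + h) < 0
          then 2 * \<bar>nbr_sum L \<sigma> i + h\<bar> else 0)"
    by (rule sum.inter_filter[OF finite_torus])
  also have "\<dots> = (\<Sum>i\<in>torus L. max 0 (?x i))"
    by (rule sum.cong[OF refl], drule spin) (auto simp: max_def abs_if)
  finally show ?thesis
    unfolding eq
    by (simp only:) (intro tendsto_minus tendsto_sum ln_one_plus_exp_over_tendsto)
qed

lemma energy_cost_eq:
  assumes "\<eta> \<in> configs L"
  shows "energy_cost L h \<sigma> \<eta> =
     (\<Sum>i\<in>{i \<in> torus L. real_of_int (\<eta> i) * (nbr_sum L \<sigma> i + h) < 0}.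
        2 * \<bar>nbr_sum L \<sigma> i + h\<bar>)"
  using tendsto_Lim[OF _ energy_cost_tendsto[OF assms, of h \<sigma>]]
  by (simp add: energy_cost_def)

end

theory Submission
  imports Defs
begin

text \<open>The transition energy \<open>H(\<sigma>,\<eta>) = - \<Sum>\<^sub>i \<eta>(i) S\<^sub>\<sigma>(i) - h \<Sum>\<^sub>i (\<sigma>(i) + \<eta>(i))\<close> is symmetric, and since the
  torus is bipartite (\<open>L\<close> is even) it is the sum of the nearest-neighbour Ising energies of the two
  configurations obtained by taking \<open>\<sigma>\<close> on one sublattice and \<open>\<eta>\<close> on the other. A single spin flip
  in one of the two Ising configurations, with the other one frozen, is realised by at most two PCA
  steps. If \<open>\<eta>\<close> is none of the four exceptional configurations, one of the two Ising configurations
  attached to \<open>\<eta>\<close> and its zero-temperature image is not constant, and a nonconstant Ising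
  configuration can lower its energy by single flips over a barrier of at most \<open>4\<close>: unless some flip
  lowers the energy, it is a local minimum, and a flat side of a plus cluster can be advanced or
  retracted. Finally \<open>4 < \<Gamma>\<close> for every \<open>h\<close> in \<open>(0,1)\<close>.\<close>

section \<open>Neighbourhoods and the symmetry of the interaction\<close>

definition nbrs :: "nat \<Rightarrow> site \<Rightarrow> site set" where
  "nbrs L i = {j \<in> torus L. torus_dist L i j = 1}"

lemma nbr_sum_nbrs: "nbr_sum L \<sigma> i = (\<Sum>j\<in>nbrs L i. real_of_int (\<sigma> j))"
  by (simp add: nbr_sum_def nbrs_def)

lemma torus_dist_commute: "torus_dist L i j = torus_dist L j i"
  by (simp add: torus_dist_def circ_dist_def abs_minus_commute)

lemma nbrs_sym: "i \<in> torus L \<Longrightarrow> j \<in> nbrs L i \<Longrightarrow> i \<in> nbrs L j"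
  by (simp add: nbrs_def torus_dist_commute)

lemma not_self_nbr: "i \<notin> nbrs L i"
  by (simp add: nbrs_def torus_dist_def circ_dist_def)

lemma finite_nbrs: "finite (nbrs L i)"
  by (simp add: nbrs_def finite_torus)

text \<open>With an index set that does not depend on \<open>i\<close>, double sums over bonds can
  be swapped.\<close>

lemma nbr_sum_torus:
  "nbr_sum L \<sigma> i = (\<Sum>j\<in>torus L. if j \<in> nbrs L i then real_of_int (\<sigma> j) else 0)"
proof -
  have "nbrs L i = {j \<in> torus L. j \<in> nbrs L i}"
    by (auto simp: nbrs_def)
  then have "nbr_sum L \<sigma> i = (\<Sum>j\<in>{j \<in> torus L. j \<in> nbrs L i}. real_of_int (\<sigma> j))"
    by (simp only: nbr_sum_nbrs)
  also have "\<dots> = (\<Sum>j\<in>torus L. if j \<in> nbrs L i then real_of_int (\<sigma> j) else 0)"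
    by (rule sum.inter_filter[OF finite_torus])
  finally show ?thesis .
qed

lemma spin_cases: "\<sigma> \<in> configs L \<Longrightarrow> i \<in> torus L \<Longrightarrow> \<sigma> i = -1 \<or> \<sigma> i = 1"
  by (auto simp: configs_def)

lemma configs_upd:
  "\<sigma> \<in> configs L \<Longrightarrow> i \<in> torus L \<Longrightarrow> a = -1 \<or> a = 1 \<Longrightarrow> \<sigma>(i := a) \<in> configs L"
  by (auto simp: configs_def PiE_iff extensional_def)

lemma nbr_sum_symmetric:
  "(\<Sum>i\<in>torus L. real_of_int (\<eta> i) * nbr_sum L \<sigma> i) =
   (\<Sum>i\<in>torus L. real_of_int (\<sigma> i) * nbr_sum L \<eta> i)"
proof -
  have "(\<Sum>i\<in>torus L. real_of_int (\<eta> i) * nbr_sum L \<sigma> i) =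
      (\<Sum>i\<in>torus L. \<Sum>j\<in>torus L. if j \<in> nbrs L i then real_of_int (\<eta> i) * real_of_int (\<sigma> j) else 0)"
    unfolding nbr_sum_torus sum_distrib_left by (intro sum.cong refl) auto
  also have "\<dots> = (\<Sum>j\<in>torus L. \<Sum>i\<in>torus L. if j \<in> nbrs L i then real_of_int (\<eta> i) * real_of_int (\<sigma> j) else 0)"
    by (rule sum.swap)
  also have "\<dots> = (\<Sum>i\<in>torus L. real_of_int (\<sigma> i) * nbr_sum L \<eta> i)"
    unfolding nbr_sum_torus sum_distrib_left
    by (intro sum.cong refl) (auto dest: nbrs_sym)
  finally show ?thesis .
qed


section \<open>The Ising energy\<close>

text \<open>The nearest-neighbour Ising Hamiltonian with coupling 1 and field \<open>h\<close>: the
  sum over sites meets each bond from both ends, hence the division by 2.\<close>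

definition ising :: "nat \<Rightarrow> real \<Rightarrow> config \<Rightarrow> real" where
  "ising L h \<xi> = - (\<Sum>i\<in>torus L. real_of_int (\<xi> i) * nbr_sum L \<xi> i) / 2
     - h * (\<Sum>i\<in>torus L. real_of_int (\<xi> i))"

lemma ising_flip:
  assumes i: "i \<in> torus L" and a: "\<xi> i = - a"
  shows "ising L h (\<xi>(i := a)) = ising L h \<xi> - 2 * real_of_int a * (nbr_sum L \<xi> i + h)"
proof -
  let ?A = "real_of_int a" and ?x = "\<lambda>j. real_of_int (\<xi> j)"
  let ?d = "\<lambda>j. if j = i then 2 * ?A else 0"
  have spin: "real_of_int ((\<xi>(i := a)) j) = ?x j + ?d j" for j
    using a by auto
  have S: "nbr_sum L (\<xi>(i := a)) j = nbr_sum L \<xi> j + (if j \<in> nbrs L i then 2 * ?A else 0)"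
    if "j \<in> torus L" for j
  proof -
    have "nbr_sum L (\<xi>(i := a)) j = (\<Sum>k\<in>nbrs L j. ?x k + ?d k)"
      unfolding nbr_sum_nbrs spin ..
    also have "\<dots> = nbr_sum L \<xi> j + (if i \<in> nbrs L j then 2 * ?A else 0)"
      by (simp add: sum.distrib nbr_sum_nbrs finite_nbrs)
    finally show ?thesis
      using nbrs_sym i that by metis
  qed
  \<comment> \<open>The product of the two corrections, one to the spin at \<open>j\<close> and one
    to its neighbour sum, vanishes because \<open>i\<close> is not its own neighbour.\<close>
  have "(\<Sum>j\<in>torus L. real_of_int ((\<xi>(i := a)) j) * nbr_sum L (\<xi>(i := a)) j) =
     (\<Sum>j\<in>torus L. ?x j * nbr_sum L \<xi> j + (if j = i then 2 * ?A * nbr_sum L \<xi> i else 0)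
        + 2 * ?A * (if j \<in> nbrs L i then ?x j else 0))"
    unfolding spin using not_self_nbr[of i L]
    by (intro sum.cong refl) (auto simp: S algebra_simps)
  also have "\<dots> = (\<Sum>j\<in>torus L. ?x j * nbr_sum L \<xi> j) + 4 * ?A * nbr_sum L \<xi> i"
    unfolding sum.distrib sum_distrib_left[symmetric] nbr_sum_torus[symmetric]
    using i by (simp add: finite_torus)
  finally have B: "(\<Sum>j\<in>torus L. real_of_int ((\<xi>(i := a)) j) * nbr_sum L (\<xi>(i := a)) j) =
     (\<Sum>j\<in>torus L. ?x j * nbr_sum L \<xi> j) + 4 * ?A * nbr_sum L \<xi> i" .
  have M: "(\<Sum>j\<in>torus L. real_of_int ((\<xi>(i := a)) j)) = (\<Sum>j\<in>torus L. ?x j) + 2 * ?A"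
    unfolding spin sum.distrib using i by (simp add: finite_torus)
  show ?thesis
    unfolding ising_def B M by (simp add: field_simps)
qed

text \<open>The new value \<open>a\<close> may equal the old spin, so rewriting a row site by site
  is a chain of steps without any case distinction.\<close>

definition flip_step :: "nat \<Rightarrow> real \<Rightarrow> real \<Rightarrow> config \<Rightarrow> config \<Rightarrow> bool" where
  "flip_step L h c \<xi> \<xi>' \<longleftrightarrow>
     (\<exists>i\<in>torus L. \<exists>a\<in>{-1, 1}. \<xi> \<in> configs L \<and> \<xi>' = \<xi>(i := a)) \<and>
     ising L h \<xi> \<le> c \<and> ising L h \<xi>' \<le> c"

abbreviation flip_reach :: "nat \<Rightarrow> real \<Rightarrow> real \<Rightarrow> config \<Rightarrow> config \<Rightarrow> bool" where
  "flip_reach L h c \<equiv> (flip_step L h c)\<^sup>*\<^sup>*"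

section \<open>Pair energy and reduction to the Ising model\<close>

text \<open>With local field \<open>x\<close> and spin \<open>\<eta> i\<close> of modulus 1, the
  cost at \<open>i\<close> is \<bar>x\<bar> minus \<open>\<eta> i * x\<close>, so the absolute
  values in the virtual energy cancel.\<close>

lemma trans_energy_eq:
  assumes "\<eta> \<in> configs L"
  shows "trans_energy L h \<sigma> \<eta> =
     - (\<Sum>i\<in>torus L. real_of_int (\<eta> i) * nbr_sum L \<sigma> i)
     - h * (\<Sum>i\<in>torus L. real_of_int (\<sigma> i)) - h * (\<Sum>i\<in>torus L. real_of_int (\<eta> i))"
proof -
  let ?x = "\<lambda>i. nbr_sum L \<sigma> i + h"
  have "energy_cost L h \<sigma> \<eta> = (\<Sum>i\<in>torus L.
      if real_of_int (\<eta> i) * ?x i < 0 then 2 * \<bar>?x i\<bar> else 0)"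
    unfolding energy_cost_eq[OF assms] by (rule sum.inter_filter[OF finite_torus])
  also have "\<dots> = (\<Sum>i\<in>torus L. \<bar>?x i\<bar> - real_of_int (\<eta> i) * ?x i)"
    by (rule sum.cong[OF refl], drule spin_cases[OF assms]) (auto simp: abs_if)
  finally show ?thesis
    by (simp add: trans_energy_def energy_def sum_subtractf sum_negf sum.distrib sum_distrib_left algebra_simps)
qed

lemma energy_le_trans_energy:
  assumes "\<eta> \<in> configs L"
  shows "energy L h \<sigma> \<le> trans_energy L h \<sigma> \<eta>"
  unfolding trans_energy_def energy_cost_eq[OF assms] by (simp add: sum_nonneg)

definition zero_temp :: "nat \<Rightarrow> real \<Rightarrow> config \<Rightarrow> config" where
  "zero_temp L h \<sigma> = (\<lambda>i\<in>torus L. if nbr_sum L \<sigma> i + h < 0 then -1 else 1)"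

lemma zero_temp_configs: "zero_temp L h \<sigma> \<in> configs L"
  by (auto simp: zero_temp_def configs_def)

text \<open>Following the sign of the local field is free. This presents the virtual energy as a
  transition energy, the quantity that splits into Ising energies.\<close>

lemma trans_energy_zero_temp: "trans_energy L h \<sigma> (zero_temp L h \<sigma>) = energy L h \<sigma>"
proof -
  have "{i \<in> torus L. real_of_int (zero_temp L h \<sigma> i) * (nbr_sum L \<sigma> i + h) < 0} = {}"
    by (auto simp: zero_temp_def split: if_splits)
  then show ?thesis
    unfolding trans_energy_def energy_cost_eq[OF zero_temp_configs] by (simp only: sum.empty add_0_right)
qed

definition mix :: "config \<Rightarrow> config \<Rightarrow> config" where
  "mix \<sigma> \<eta> = (\<lambda>i. if even (fst i + snd i) then \<sigma> i else \<eta> i)"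

lemma mix_apply: "mix \<sigma> \<eta> i = (if even (fst i + snd i) then \<sigma> i else \<eta> i)"
  by (simp add: mix_def)

lemma mix_configs: "\<sigma> \<in> configs L \<Longrightarrow> \<eta> \<in> configs L \<Longrightarrow> mix \<sigma> \<eta> \<in> configs L"
  by (auto simp: configs_def mix_def PiE_iff extensional_def)

text \<open>Forming both mixtures is an involution on pairs, so any two Ising configurations can be
  prescribed and the PCA transition recovered from them.\<close>

lemma mix_mix: "mix (mix \<sigma> \<eta>) (mix \<eta> \<sigma>) = \<sigma>"
  by (auto simp: mix_def)

lemma circ_dist_int:
  "circ_dist L a b = real_of_int (min \<bar>int a - int b\<bar> (int L - \<bar>int a - int b\<bar>))"
  by (simp add: circ_dist_def of_int_min)

lemma int_sum_squares_1: "(a::int)\<^sup>2 + b\<^sup>2 = 1 \<longleftrightarrow> (\<bar>a\<bar> = 1 \<and> b = 0) \<or> (a = 0 \<and> \<bar>b\<bar> = 1)"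
proof
  assume *: "a\<^sup>2 + b\<^sup>2 = 1"
  then have "a\<^sup>2 \<le> 1" "b\<^sup>2 \<le> 1"
    using zero_le_power2[of a] zero_le_power2[of b] by linarith+
  then have "\<bar>a\<bar> \<le> 1" "\<bar>b\<bar> \<le> 1"
    by (simp_all add: abs_square_le_1)
  then have "a = -1 \<or> a = 0 \<or> a = 1" "b = -1 \<or> b = 0 \<or> b = 1"
    by linarith+
  then show "(\<bar>a\<bar> = 1 \<and> b = 0) \<or> (a = 0 \<and> \<bar>b\<bar> = 1)"
    using * by auto
qed (auto simp: power2_eq_square abs_if split: if_splits)

text \<open>Circular distances of sites are integers, and two integer squares add up to 1 only as 0
  and 1. The value \<open>L - 1\<close> is a step across the periodic boundary.\<close>

lemma torus_dist_1_iff: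
  assumes "i \<in> torus L" "j \<in> torus L" "2 \<le> L"
  shows "torus_dist L i j = 1 \<longleftrightarrow>
    (fst i = fst j \<and> \<bar>int (snd i) - int (snd j)\<bar> \<in> {1, int L - 1}) \<or>
    (snd i = snd j \<and> \<bar>int (fst i) - int (fst j)\<bar> \<in> {1, int L - 1})"
proof -
  let ?m = "\<lambda>a b. min \<bar>int a - int b\<bar> (int L - \<bar>int a - int b\<bar>)"
  have b: "fst i < L" "snd i < L" "fst j < L" "snd j < L"
    using assms by (auto simp: torus_def)
  have m0: "?m a b = 0 \<longleftrightarrow> a = b" and m1: "\<bar>?m a b\<bar> = 1 \<longleftrightarrow> \<bar>int a - int b\<bar> \<in> {1, int L - 1}"
    if "a < L" "b < L" for a b
    using that assms(3) by (auto simp: min_def abs_if split: if_splits)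
  have "torus_dist L i j = 1 \<longleftrightarrow> (?m (fst i) (fst j))\<^sup>2 + (?m (snd i) (snd j))\<^sup>2 = 1"
    unfolding torus_dist_def circ_dist_int real_sqrt_eq_1_iff
      of_int_power[symmetric] of_int_add[symmetric] of_int_eq_1_iff ..
  then show ?thesis
    unfolding int_sum_squares_1 m0[OF b(1,3)] m0[OF b(2,4)] m1[OF b(1,3)] m1[OF b(2,4)] by blast
qed

text \<open>Both possible coordinate differences, \<open>1\<close> and \<open>L - 1\<close>, are odd
  for even \<open>L\<close>: the torus is bipartite.\<close>

lemma nbrs_parity:
  assumes "i \<in> torus L" "j \<in> nbrs L i" "even L"
  shows "even (fst j + snd j) \<longleftrightarrow> odd (fst i + snd i)"
proof -
  have "L \<noteq> 0"
    using assms(1) by (auto simp: torus_def)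
  with assms(3) have L: "2 \<le> L"
    by (cases "L = 1") auto
  have key: "even (a + b) \<longleftrightarrow> odd (a + c)" if "\<bar>int b - int c\<bar> \<in> {1, int L - 1}" for a b c
  proof -
    have "odd \<bar>int b - int c\<bar>"
    proof -
      have "odd (1::int)" "odd (int L - 1)"
        using assms(3) by simp_all
      then show ?thesis
        using that by (metis empty_iff insert_iff)
    qed
    then have "odd (int b - int c)"
      by simp
    then have "even (int b) \<longleftrightarrow> odd (int c)"
      by presburger
    then show ?thesis
      by simp
  qed
  have "j \<in> torus L" "torus_dist L i j = 1"
    using assms(2) by (auto simp: nbrs_def)
  then show ?thesis
    using torus_dist_1_iff[OF assms(1) _ L, of j] key[of "snd i" "snd j" "fst i"]
      key[of "fst i" "fst j" "snd i"]
    by (auto simp: add.commute)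
qed

text \<open>On a bipartite lattice the pair energy splits into two independent Ising energies,
  because the new even spins only interact with the old odd spins and vice versa.\<close>

lemma trans_energy_mix:
  assumes "\<eta> \<in> configs L" "even L"
  shows "trans_energy L h \<sigma> \<eta> = ising L h (mix \<sigma> \<eta>) + ising L h (mix \<eta> \<sigma>)"
proof -
  let ?m = "mix \<sigma> \<eta>" and ?n = "mix \<eta> \<sigma>"
  \<comment> \<open>All neighbours of an even site are odd, and there
    \<open>mix \<alpha> \<gamma>\<close> reads \<gamma>; likewise with the roles exchanged.\<close>
  have S: "nbr_sum L (mix \<alpha> \<gamma>) i = nbr_sum L (if even (fst i + snd i) then \<gamma> else \<alpha>) i"
    if "i \<in> torus L" for \<alpha> \<gamma> i
    unfolding nbr_sum_nbrs
    by (rule sum.cong[OF refl]) (use nbrs_parity[OF that _ assms(2)] in \<open>auto simp: mix_def\<close>)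
  have "(\<Sum>i\<in>torus L. real_of_int (?m i) * nbr_sum L ?m i) +
        (\<Sum>i\<in>torus L. real_of_int (?n i) * nbr_sum L ?n i) =
        (\<Sum>i\<in>torus L. real_of_int (\<eta> i) * nbr_sum L \<sigma> i) +
        (\<Sum>i\<in>torus L. real_of_int (\<sigma> i) * nbr_sum L \<eta> i)"
    unfolding sum.distrib[symmetric]
  proof (rule sum.cong[OF refl])
    fix i assume i: "i \<in> torus L"
    show "real_of_int (?m i) * nbr_sum L ?m i + real_of_int (?n i) * nbr_sum L ?n i =
        real_of_int (\<eta> i) * nbr_sum L \<sigma> i + real_of_int (\<sigma> i) * nbr_sum L \<eta> i"
      unfolding S[OF i] mix_apply by simp
  qed
  moreover have "(\<Sum>i\<in>torus L. real_of_int (?m i)) + (\<Sum>i\<in>torus L. real_of_int (?n i)) =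
        (\<Sum>i\<in>torus L. real_of_int (\<sigma> i)) + (\<Sum>i\<in>torus L. real_of_int (\<eta> i))"
    unfolding sum.distrib[symmetric]
    by (rule sum.cong[OF refl]) (simp add: mix_apply)
  \<comment> \<open>The two cross sums agree by symmetry of the interaction; the resulting factor 2
    cancels the halves in \<open>ising\<close>.\<close>
  ultimately have B: "(\<Sum>i\<in>torus L. real_of_int (?m i) * nbr_sum L ?m i) +
        (\<Sum>i\<in>torus L. real_of_int (?n i) * nbr_sum L ?n i) =
        2 * (\<Sum>i\<in>torus L. real_of_int (\<eta> i) * nbr_sum L \<sigma> i)"
    and M: "h * (\<Sum>i\<in>torus L. real_of_int (?m i)) + h * (\<Sum>i\<in>torus L. real_of_int (?n i)) =
        h * (\<Sum>i\<in>torus L. real_of_int (\<sigma> i)) + h * (\<Sum>i\<in>torus L. real_of_int (\<eta> i))"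
    using nbr_sum_symmetric[where L=L and \<sigma>=\<eta> and \<eta>=\<sigma>] by (simp_all flip: distrib_left)
  show ?thesis
    unfolding trans_energy_eq[OF assms(1)] ising_def using B M by (simp add: field_simps)
qed

lemma trans_energy_mix_swap:
  assumes "\<xi> \<in> configs L" "\<zeta> \<in> configs L" "even L"
  shows "trans_energy L h (mix \<xi> \<zeta>) (mix \<zeta> \<xi>) = ising L h \<xi> + ising L h \<zeta>"
  using trans_energy_mix[OF mix_configs[OF assms(2,1)] assms(3)] by (simp add: mix_mix)

section \<open>From Ising flips to PCA paths and stability levels\<close>

definition pca_step :: "nat \<Rightarrow> real \<Rightarrow> real \<Rightarrow> config \<Rightarrow> config \<Rightarrow> bool" where
  "pca_step L h c \<sigma> \<eta> \<longleftrightarrow> \<sigma> \<in> configs L \<and> \<eta> \<in> configs L \<and> trans_energy L h \<sigma> \<eta> \<le> c"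

text \<open>The transition between \<open>mix \<alpha> \<zeta>\<close> and
  \<open>mix \<zeta> \<alpha>\<close>, in either direction, has height
  \<open>ising \<alpha> + ising \<zeta>\<close>. One such transition before the flip and one after
  it are joined at the mixture that does not see the flipped site. Both orders are stated because
  either member of the Ising pair may be the one that moves.\<close>

lemma flip_step_pca:
  assumes step: "flip_step L h c \<xi> \<xi>'" and z: "\<zeta> \<in> configs L" and L: "even L"
  shows "(pca_step L h (c + ising L h \<zeta>))\<^sup>*\<^sup>* (mix \<xi> \<zeta>) (mix \<xi>' \<zeta>)"
    and "(pca_step L h (c + ising L h \<zeta>))\<^sup>*\<^sup>* (mix \<zeta> \<xi>) (mix \<zeta> \<xi>')"
proof -
  let ?R = "pca_step L h (c + ising L h \<zeta>)"
  from step obtain i a where i: "i \<in> torus L" and a: "a \<in> {-1, 1}" and x: "\<xi> \<in> configs L"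
    and x': "\<xi>' = \<xi>(i := a)" and c: "ising L h \<xi> \<le> c" "ising L h \<xi>' \<le> c"
    by (auto simp: flip_step_def)
  have x'c: "\<xi>' \<in> configs L"
    using configs_upd[OF x i, of a] a x' by auto
  have R: "?R (mix \<alpha> \<zeta>) (mix \<zeta> \<alpha>)" "?R (mix \<zeta> \<alpha>) (mix \<alpha> \<zeta>)"
    if "\<alpha> \<in> configs L" "ising L h \<alpha> \<le> c" for \<alpha>
    using that z L by (auto simp: pca_step_def mix_configs trans_energy_mix_swap)
  have "mix \<zeta> \<xi> = mix \<zeta> \<xi>' \<or> mix \<xi> \<zeta> = mix \<xi>' \<zeta>"
  proof (cases "even (fst i + snd i)")
    case True
    then have "mix \<zeta> \<xi> = mix \<zeta> \<xi>'"
      unfolding x' by (intro ext) (simp add: mix_apply)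
    then show ?thesis ..
  next
    case False
    then have "mix \<xi> \<zeta> = mix \<xi>' \<zeta>"
      unfolding x' by (intro ext) (simp add: mix_apply)
    then show ?thesis ..
  qed
  then show "?R\<^sup>*\<^sup>* (mix \<xi> \<zeta>) (mix \<xi>' \<zeta>)" "?R\<^sup>*\<^sup>* (mix \<zeta> \<xi>) (mix \<zeta> \<xi>')"
    using R[OF x c(1)] R[OF x'c c(2)]
    by (metis converse_rtranclp_into_rtranclp rtranclp.rtrancl_refl)+
qed

lemma flip_reach_pca:
  assumes "flip_reach L h c \<xi> \<xi>'" "\<zeta> \<in> configs L" "even L"
  shows "(pca_step L h (c + ising L h \<zeta>))\<^sup>*\<^sup>* (mix \<xi> \<zeta>) (mix \<xi>' \<zeta>)"
    and "(pca_step L h (c + ising L h \<zeta>))\<^sup>*\<^sup>* (mix \<zeta> \<xi>) (mix \<zeta> \<xi>')"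
  using assms(1)
  by (induction rule: rtranclp_induct) (auto intro: rtranclp_trans flip_step_pca[OF _ assms(2,3)])

text \<open>The bound concerns single transitions and not \<open>path_height\<close>, because the
  base case is a one-point path, whose height is its energy and need not lie below
  \<open>c\<close>.\<close>

lemma pca_reach_path:
  assumes "(pca_step L h c)\<^sup>*\<^sup>* \<sigma> \<eta>" "\<sigma> \<in> configs L"
  shows "\<exists>\<omega> \<in> paths L \<sigma> \<eta>. \<forall>k. Suc k < length \<omega> \<longrightarrow> trans_energy L h (\<omega> ! k) (\<omega> ! Suc k) \<le> c"
  using assms
proof (induction rule: rtranclp_induct)
  case base
  then show ?case
    by (intro bexI[of _ "[\<sigma>]"]) (auto simp: paths_def)
next
  case (step \<eta> \<theta>)
  then obtain \<omega> where w: "\<omega> \<in> paths L \<sigma> \<eta>"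
    and le: "\<And>k. Suc k < length \<omega> \<Longrightarrow> trans_energy L h (\<omega> ! k) (\<omega> ! Suc k) \<le> c"
    by blast
  have ne: "\<omega> \<noteq> []" and last: "last \<omega> = \<eta>"
    using w by (auto simp: paths_def)
  have "\<omega> @ [\<theta>] \<in> paths L \<sigma> \<theta>"
    using w step.hyps(2) by (auto simp: paths_def pca_step_def)
  moreover have "trans_energy L h ((\<omega> @ [\<theta>]) ! k) ((\<omega> @ [\<theta>]) ! Suc k) \<le> c"
    if "Suc k < length (\<omega> @ [\<theta>])" for k
  proof (cases "Suc k < length \<omega>")
    case True
    then show ?thesis
      using le[OF True] by (simp add: nth_append)
  next
    case False
    with that ne have "k = length \<omega> - 1" "Suc k = length \<omega>"
      by auto
    then show ?thesis
      using step.hyps(2) ne last by (simp add: nth_append last_conv_nth pca_step_def)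
  qed
  ultimately show ?case
    by blast
qed

lemma stability_level_le:
  assumes reach: "(pca_step L h c)\<^sup>*\<^sup>* \<sigma> \<eta>" and \<sigma>: "\<sigma> \<in> configs L" and \<eta>: "\<eta> \<in> configs L"
    and lower: "energy L h \<eta> < energy L h \<sigma>"
  shows "stability_level L h \<sigma> \<le> ereal (c - energy L h \<sigma>)"
proof -
  have mem: "\<eta> \<in> lower_configs L h \<sigma>"
    using \<eta> lower by (simp add: lower_configs_def)
  obtain \<omega> where w: "\<omega> \<in> paths L \<sigma> \<eta>"
    and le: "\<And>k. Suc k < length \<omega> \<Longrightarrow> trans_energy L h (\<omega> ! k) (\<omega> ! Suc k) \<le> c"
    using pca_reach_path[OF reach \<sigma>] by blast
  \<comment> \<open>Different energies make the endpoints distinct, so the path has a transition and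
    its height is the maximum over transitions.\<close>
  have ends: "\<omega> \<noteq> []" "hd \<omega> = \<sigma>" "last \<omega> = \<eta>" "\<sigma> \<noteq> \<eta>"
    using w lower by (auto simp: paths_def)
  then have len: "length \<omega> \<noteq> 1" "1 < length \<omega>"
    by (auto simp: length_Suc_conv neq_Nil_conv)
  have "comm_height_sets L h {\<sigma>} (lower_configs L h \<sigma>) \<le> comm_height L h \<sigma> \<eta>"
    unfolding comm_height_sets_def using mem
    by (intro Min_le) (auto simp: finite_lower_configs)
  also have "\<dots> \<le> path_height L h \<omega>"
    unfolding comm_height_def by (intro Min_le finite_path_heights imageI w)
  also have "\<dots> \<le> c"
  proof -
    have "finite {k. Suc k < length \<omega>}"
      by (rule finite_subset[of _ "{..<length \<omega>}"]) auto
    moreover have "0 \<in> {k. Suc k < length \<omega>}"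
      using len by simp
    ultimately show ?thesis
      unfolding path_height_def using len le by (auto intro!: Max.boundedI)
  qed
  finally show ?thesis
    unfolding stability_level_def using mem by auto
qed

section \<open>Coordinate frames on the torus\<close>

text \<open>A doubly periodic labelling of the torus by integer pairs in which neighbours are unit
  shifts. Translations, transposition and reflection preserve frames, so one orientation of a
  droplet side stands for all. Neighbours are given as a set, which stays correct for
  \<open>L = 2\<close>, where opposite shifts coincide.\<close>

definition frame :: "nat \<Rightarrow> (int \<Rightarrow> int \<Rightarrow> site) \<Rightarrow> bool" where
  "frame L f \<longleftrightarrow> (\<forall>s t. f s t \<in> torus L) \<and>
     (\<forall>s t s' t'. f s t = f s' t' \<longleftrightarrow> s mod int L = s' mod int L \<and> t mod int L = t' mod int L) \<and>
     (\<forall>s t. nbrs L (f s t) = {f (s + 1) t, f (s - 1) t, f s (t + 1), f s (t - 1)})"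

definition wrap :: "nat \<Rightarrow> int \<Rightarrow> int \<Rightarrow> site" where
  "wrap L x y = (nat (x mod int L), nat (y mod int L))"

lemma wrap_nat: "a < L \<Longrightarrow> b < L \<Longrightarrow> wrap L (int a) (int b) = (a, b)"
  by (simp add: wrap_def)

lemma mod_shift_cases:
  fixes a b n :: int
  assumes "0 \<le> a" "a < n" "0 \<le> b" "b < n" "2 \<le> n"
  shows "\<bar>a - b\<bar> \<in> {1, n - 1} \<longleftrightarrow> b = (a + 1) mod n \<or> b = (a - 1) mod n"
proof -
  have "(a + 1) mod n = (if a = n - 1 then 0 else a + 1)"
    using assms by auto
  moreover have "(a - 1) mod n = (if a = 0 then n - 1 else a - 1)"
    using assms mod_pos_pos_trivial[of "a - 1" n] by (auto simp: zmod_minus1)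
  ultimately show ?thesis
    using assms by (auto simp: abs_if split: if_splits)
qed

lemma frame_wrap:
  assumes L: "2 \<le> L"
  shows "frame L (wrap L)"
proof -
  have mem: "wrap L x y \<in> torus L" for x y
    using L by (auto simp: wrap_def torus_def nat_less_iff)
  have inj: "wrap L s t = wrap L s' t' \<longleftrightarrow> s mod int L = s' mod int L \<and> t mod int L = t' mod int L"
    for s t s' t'
    using L by (auto simp: wrap_def eq_nat_nat_iff)
  have "j \<in> nbrs L (wrap L s t) \<longleftrightarrow>
      j \<in> {wrap L (s + 1) t, wrap L (s - 1) t, wrap L s (t + 1), wrap L s (t - 1)}" for j s t
  proof (cases "j \<in> torus L")
    case True
    obtain a b where j: "j = (a, b)" by fastforce
    have ab: "a < L" "b < L"
      using True j by (auto simp: torus_def)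
    define x y where "x = s mod int L" and "y = t mod int L"
    have xy: "0 \<le> x" "x < int L" "0 \<le> y" "y < int L"
      using L by (auto simp: x_def y_def)
    have w: "j = wrap L p q \<longleftrightarrow> int a = p mod int L \<and> int b = q mod int L" for p q
      using L unfolding j wrap_def by (auto simp: nat_eq_iff)
    have m: "(s + 1) mod int L = (x + 1) mod int L" "(s - 1) mod int L = (x - 1) mod int L"
       "(t + 1) mod int L = (y + 1) mod int L" "(t - 1) mod int L = (y - 1) mod int L"
      unfolding x_def y_def by (simp_all add: mod_simps)
    have "j \<in> nbrs L (wrap L s t) \<longleftrightarrow> torus_dist L (wrap L s t) j = 1"
      using True by (simp add: nbrs_def)
    also have "\<dots> \<longleftrightarrow> (x = int a \<and> \<bar>y - int b\<bar> \<in> {1, int L - 1}) \<or> (y = int b \<and> \<bar>x - int a\<bar> \<in> {1, int L - 1})"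
      unfolding torus_dist_1_iff[OF mem True L] using xy
      by (simp add: wrap_def j nat_eq_iff flip: x_def y_def)
    also have "\<dots> \<longleftrightarrow> j \<in> {wrap L (s + 1) t, wrap L (s - 1) t, wrap L s (t + 1), wrap L s (t - 1)}"
      unfolding insert_iff w m empty_iff
      using mod_shift_cases[of x "int L" "int a"] mod_shift_cases[of y "int L" "int b"] xy ab L
      by (auto simp flip: x_def y_def)
    finally show ?thesis .
  next
    case False
    then show ?thesis
      using mem by (auto simp: nbrs_def)
  qed
  then show ?thesis
    unfolding frame_def using mem inj by blast
qed

lemma frame_transpose: "frame L f \<Longrightarrow> frame L (\<lambda>s t. f t s)"
  unfolding frame_def by auto

lemma frame_shift: "frame L f \<Longrightarrow> frame L (\<lambda>s t. f (s + c) (t + d))"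
  unfolding frame_def
  by (auto simp: algebra_simps mod_eq_dvd_iff)

lemma frame_reflect: "frame L f \<Longrightarrow> frame L (\<lambda>s t. f s (- t))"
  unfolding frame_def
  by (auto simp: algebra_simps mod_eq_dvd_iff)

lemma frame_torus: "frame L f \<Longrightarrow> f s t \<in> torus L"
  by (simp add: frame_def)

text \<open>For \<open>L\<close> at least 3 the four shifts are distinct sites, as \<open>L\<close>
  divides neither 1 nor 2.\<close>

lemma frame_nbr_sum:
  assumes f: "frame L f" and L: "3 \<le> L"
  shows "nbr_sum L \<sigma> (f s t) = real_of_int (\<sigma> (f (s + 1) t)) + real_of_int (\<sigma> (f (s - 1) t))
     + real_of_int (\<sigma> (f s (t + 1))) + real_of_int (\<sigma> (f s (t - 1)))"
proof -
  have nd: "\<not> int L dvd 1" "\<not> int L dvd 2" "\<not> int L dvd -1"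
    using L zdvd_imp_le[of "int L"] by fastforce+
  have d: "s mod int L \<noteq> (s + 1) mod int L" "s mod int L \<noteq> (s - 1) mod int L"
     "(s + 1) mod int L \<noteq> (s - 1) mod int L" "(s + 1) mod int L \<noteq> s mod int L"
     "(s - 1) mod int L \<noteq> s mod int L" for s
    using nd by (auto simp: mod_eq_dvd_iff)
  have "nbrs L (f s t) = {f (s + 1) t, f (s - 1) t, f s (t + 1), f s (t - 1)}"
    using f by (simp add: frame_def)
  moreover have "f (s + 1) t \<notin> {f (s - 1) t, f s (t + 1), f s (t - 1)}"
    "f (s - 1) t \<notin> {f s (t + 1), f s (t - 1)}" "f s (t + 1) \<notin> {f s (t - 1)}"
    using f d by (auto simp: frame_def)
  ultimately show ?thesis
    by (simp add: nbr_sum_nbrs)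
qed

text \<open>If no bond had unequal spins, \<open>wrap\<close> and its transpose would propagate the
  spin at the origin to the whole torus. Transposition turns an unequal bond into the second
  direction, and reflection puts the plus spin first.\<close>

lemma boundary_frame:
  assumes L: "2 \<le> L" and x: "\<xi> \<in> configs L"
    and ne: "\<xi> \<noteq> plus_conf L" "\<xi> \<noteq> minus_conf L"
  obtains f where "frame L f" "\<xi> (f 0 0) = 1" "\<xi> (f 0 1) = -1"
proof -
  have "\<exists>f s t. frame L f \<and> \<xi> (f s t) \<noteq> \<xi> (f s (t + 1))"
  proof (rule ccontr)
    assume *: "\<not> ?thesis"
    have c: "\<xi> (wrap L s (t + 1)) = \<xi> (wrap L s t)" "\<xi> (wrap L (s + 1) t) = \<xi> (wrap L s t)" for s t
      using * frame_wrap[OF L] frame_transpose[OF frame_wrap[OF L]] by metis+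
    have 1: "\<xi> (wrap L (int a) 0) = \<xi> (wrap L 0 0)" for a
      by (induction a) (simp_all add: c add.commute[of 1])
    have 2: "\<xi> (wrap L (int a) (int b)) = \<xi> (wrap L 0 0)" for a b
      by (induction b) (simp_all add: c 1 add.commute[of 1])
    have const: "\<xi> i = \<xi> (wrap L 0 0)" if "i \<in> torus L" for i
      using that 2[of "fst i" "snd i"] by (auto simp: torus_def wrap_nat)
    have "wrap L 0 0 \<in> torus L"
      using frame_torus[OF frame_wrap[OF L]] .
    with spin_cases[OF x] have "\<xi> (wrap L 0 0) = -1 \<or> \<xi> (wrap L 0 0) = 1"
      by blast
    moreover have "\<xi> \<in> extensional (torus L)"
      using x by (simp add: configs_def PiE_iff)
    ultimately have "\<xi> = minus_conf L \<or> \<xi> = plus_conf L"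
      using const by (auto simp: minus_conf_def plus_conf_def fun_eq_iff extensional_def)
    with ne show False by blast
  qed
  then obtain f s t where f: "frame L f" and d: "\<xi> (f s t) \<noteq> \<xi> (f s (t + 1))"
    by blast
  show thesis
  proof (cases "\<xi> (f s t) = 1")
    case True
    then have "\<xi> (f s (t + 1)) = -1"
      using d spin_cases[OF x frame_torus[OF f]] by metis
    then show thesis
      using that[OF frame_shift[OF f, of s t]] True by (simp add: add.commute)
  next
    case False
    then have "\<xi> (f s t) = -1" "\<xi> (f s (t + 1)) = 1"
      using d spin_cases[OF x frame_torus[OF f]] by metis+
    then show thesis
      using that[OF frame_reflect[OF frame_shift[OF f, of s "t + 1"]]] by simp
  qed
qed

section \<open>Moving a flat side of a droplet\<close>

text \<open>The counter \<open>m\<close> makes the successive configurations a path of single-site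
  updates along \<open>r\<close>.\<close>

definition set_row :: "config \<Rightarrow> (nat \<Rightarrow> site) \<Rightarrow> int \<Rightarrow> nat \<Rightarrow> config" where
  "set_row \<xi> r a m = (\<lambda>i. if i \<in> r ` {..<m} then a else \<xi> i)"

lemma set_row_0: "set_row \<xi> r a 0 = \<xi>"
  by (simp add: set_row_def)

lemma set_row_Suc: "set_row \<xi> r a (Suc m) = (set_row \<xi> r a m)(r m := a)"
  by (auto simp: set_row_def lessThan_Suc)

lemma set_row_new:
  "inj_on r {..<n} \<Longrightarrow> m < n \<Longrightarrow> set_row \<xi> r a m (r m) = \<xi> (r m)"
  by (auto simp: set_row_def dest!: inj_onD)

lemma set_row_configs:
  assumes "\<xi> \<in> configs L" "\<And>k. r k \<in> torus L" "a = -1 \<or> a = 1"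
  shows "set_row \<xi> r a m \<in> configs L"
proof (induction m)
  case 0
  then show ?case using assms(1) by (simp add: set_row_0)
next
  case (Suc m)
  then show ?case unfolding set_row_Suc by (rule configs_upd[OF _ assms(2,3)])
qed

lemma flip_reach_set_row:
  assumes x: "\<xi> \<in> configs L" and r: "\<And>k. r k \<in> torus L" and a: "a = -1 \<or> a = 1"
    and c: "\<And>k. k \<le> m \<Longrightarrow> ising L h (set_row \<xi> r a k) \<le> c"
  shows "flip_reach L h c \<xi> (set_row \<xi> r a m)"
  using c
proof (induction m)
  case 0
  then show ?case by (simp add: set_row_0)
next
  case (Suc m)
  have "flip_step L h c (set_row \<xi> r a m) (set_row \<xi> r a (Suc m))"
    unfolding flip_step_def
  proof (intro conjI bexI[of _ "r m"] bexI[of _ a])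
    show "set_row \<xi> r a m \<in> configs L"
      by (rule set_row_configs[OF x r a])
    show "set_row \<xi> r a (Suc m) = (set_row \<xi> r a m)(r m := a)"
      by (rule set_row_Suc)
    show "a \<in> {-1, 1}" "r m \<in> torus L"
      using a r by auto
  qed (use Suc.prems in simp_all)
  then show ?case
    using Suc by (meson le_SucI rtranclp.rtrancl_into_rtrancl)
qed

lemma frame_row_inj:
  assumes "frame L f"
  shows "inj_on (\<lambda>k. f (int k) t) {..<L}"
  using assms by (auto simp: inj_on_def frame_def)

lemma frame_period: "frame L f \<Longrightarrow> f (s + int L) t = f s t"
  by (simp add: frame_def)

text \<open>The first flip has at least the plus below it, so its neighbour sum is at least -2 and
  it costs at most 4 - 2h. Every later flip also has the new plus on its left, so the sum is at
  least 0 and the energy drops by at least 2h.\<close>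

lemma grow_row_energy:
  assumes f: "frame L f" and L: "3 \<le> L" and x: "\<xi> \<in> configs L" and h: "0 < h"
    and n: "n \<le> L"
    and below: "\<And>k. k < n \<Longrightarrow> \<xi> (f (int k) 0) = 1"
    and row: "\<And>k. k < n \<Longrightarrow> \<xi> (f (int k) 1) = -1"
    and m: "m < n"
  shows "ising L h (set_row \<xi> (\<lambda>k. f (int k) 1) 1 (Suc m)) \<le> ising L h \<xi> + 4 - 2 * h * real (Suc m)"
  using m
proof (induction m)
  let ?r = "\<lambda>k. f (int k) 1" let ?g = "set_row \<xi> ?r 1"
  have rt: "?r k \<in> torus L" for k
    using frame_torus[OF f] .
  have gm: "?g m \<in> configs L" for m
    using set_row_configs[OF x, of ?r 1 m] rt by simp
  have sp: "?g m (f s t) = -1 \<or> ?g m (f s t) = 1" for m s t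
    using spin_cases[OF gm frame_torus[OF f]] .
  have up: "?g m i = 1" if "\<xi> i = 1" for m i
    using that by (simp add: set_row_def)
  have step: "ising L h (?g (Suc m)) = ising L h (?g m) - 2 * (nbr_sum L (?g m) (?r m) + h)"
    if "m < n" for m
    unfolding set_row_Suc
    using ising_flip[OF rt, of "?g m" m 1 h] set_row_new[OF frame_row_inj[OF f, of 1], of m \<xi> 1]
      row[OF that] that n by simp
  have S: "nbr_sum L (?g m) (?r m) = real_of_int (?g m (f (int m + 1) 1)) +
      real_of_int (?g m (f (int m - 1) 1)) + real_of_int (?g m (f (int m) 2)) + real_of_int (?g m (f (int m) 0))"
    for m
    using frame_nbr_sum[OF f L, of "?g m" "int m" 1] by simp
  {
    case 0
    have "nbr_sum L (?g 0) (?r 0) \<ge> -2"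
      unfolding S using up[OF below[OF 0], of 0] sp[of 0 1 1] sp[of 0 "-1" 1] sp[of 0 0 2] by auto
    then show ?case
      using step[OF 0] by (simp add: set_row_0)
  next
    case (Suc m)
    have "?g (Suc m) (f (int (Suc m) - 1) 1) = 1"
      by (simp add: set_row_def)
    then have "nbr_sum L (?g (Suc m)) (?r (Suc m)) \<ge> 0"
      unfolding S using up[OF below[OF Suc.prems], of "Suc m"] sp[of "Suc m" "int (Suc m) + 1" 1]
         sp[of "Suc m" "int (Suc m)" 2] by auto
    then show ?case
      using step[OF Suc.prems] Suc.IH Suc.prems by (simp add: algebra_simps)
  }
qed

text \<open>The total change is at most 4 - 2hn, negative once hn exceeds 2. If the row closes up
  around the torus, the last site has three plus neighbours, which recovers the initial cost of 4
  for any length.\<close>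

lemma grow_row:
  assumes f: "frame L f" and L: "3 \<le> L" and x: "\<xi> \<in> configs L" and h: "0 < h"
    and n: "n \<le> L" "0 < n"
    and below: "\<And>k. k < n \<Longrightarrow> \<xi> (f (int k) 0) = 1"
    and row: "\<And>k. k < n \<Longrightarrow> \<xi> (f (int k) 1) = -1"
    and long: "2 < h * real n \<or> n = L"
  shows "\<exists>\<xi>'. flip_reach L h (ising L h \<xi> + 4) \<xi> \<xi>' \<and> ising L h \<xi>' < ising L h \<xi>"
proof -
  let ?r = "\<lambda>k. f (int k) 1" let ?g = "set_row \<xi> ?r 1"
  have rt: "?r k \<in> torus L" for k
    using frame_torus[OF f] .
  have gm: "?g m \<in> configs L" for m
    using set_row_configs[OF x, of ?r 1 m] rt by simp
  have sp: "?g m (f s t) = -1 \<or> ?g m (f s t) = 1" for m s t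
    using spin_cases[OF gm frame_torus[OF f]] .
  note E = grow_row_energy[OF f L x h n(1) below row]
  have "ising L h (?g k) \<le> ising L h \<xi> + 4" if "k \<le> n" for k
  proof (cases k)
    case (Suc j)
    then show ?thesis
      using E[of j] that h by (smt (verit) Suc_le_lessD mult_nonneg_nonneg of_nat_0_le_iff)
  qed (simp add: set_row_0)
  then have reach: "flip_reach L h (ising L h \<xi> + 4) \<xi> (?g n)"
    by (intro flip_reach_set_row[OF x rt]) auto
  have "ising L h (?g n) < ising L h \<xi>"
  proof (cases "2 < h * real n")
    case True
    then show ?thesis
      using E[of "n - 1"] n by simp
  next
    case False
    with long have nL: "n = L" by blast
    define m where "m = n - 1"
    have m: "n = Suc m" "m < n" "0 < m"
      using nL L by (auto simp: m_def)
    have lt: "ising L h (?g m) \<le> ising L h \<xi> + 4 - 2 * h * real m"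
      using E[of "m - 1"] m by simp
    \<comment> \<open>By periodicity the right neighbour of the last site is the first site, already
      plus.\<close>
    have "f (int m + 1) 1 = f (int 0) 1"
      using frame_period[OF f, of 0 1] m nL by (simp add: add.commute)
    moreover have "f (int 0) 1 \<in> ?r ` {..<m}"
      using m by blast
    ultimately have 1: "?g m (f (int m + 1) 1) = 1"
      by (simp add: set_row_def)
    have "f (int m - 1) 1 = f (int (m - 1)) 1"
      using m by (simp add: of_nat_diff)
    moreover have "f (int (m - 1)) 1 \<in> ?r ` {..<m}"
      using m(3) by (intro image_eqI[of _ _ "m - 1"]) simp_all
    ultimately have 2: "?g m (f (int m - 1) 1) = 1"
      by (simp add: set_row_def)
    have 3: "?g m (f (int m) 0) = 1"
      using below m by (simp add: set_row_def)
    have "nbr_sum L (?g m) (?r m) \<ge> 2"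
      using frame_nbr_sum[OF f L, of "?g m" "int m" 1] 1 2 3 sp[of m "int m" 2] by auto
    moreover have "ising L h (?g n) = ising L h (?g m) - 2 * (nbr_sum L (?g m) (?r m) + h)"
      unfolding m(1) set_row_Suc
      using ising_flip[OF rt, of "?g m" m 1 h] set_row_new[OF frame_row_inj[OF f, of 1], of m \<xi> 1]
        row[OF m(2)] m(2) n by simp
    ultimately have "ising L h (?g n) \<le> ising L h (?g m) - 2 * (2 + h)"
      by simp
    also have "\<dots> \<le> ising L h \<xi> - 2 * h * real m - 2 * h"
      using lt by simp
    also have "\<dots> < ising L h \<xi>"
      using h by (smt (verit) mult_nonneg_nonneg of_nat_0_le_iff)
    finally show ?thesis .
  qed
  with reach show ?thesis by blast
qed

text \<open>Erasing from the left, each site has a minus on its left and above, so a flip costs at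
  most 2h and the barrier is at most 2hn, hence at most 4. The last site also has a minus on its
  right and gains at least 4 - 2h, leaving a total of at most 2hn - 4. This can vanish when hn is 2,
  hence the weak inequality.\<close>

lemma shrink_row:
  assumes f: "frame L f" and L: "3 \<le> L" and x: "\<xi> \<in> configs L" and h: "0 < h"
    and n: "n < L" "0 < n"
    and row: "\<And>k. k < n \<Longrightarrow> \<xi> (f (int k) 0) = 1"
    and above: "\<And>k. k < n \<Longrightarrow> \<xi> (f (int k) 1) = -1"
    and left: "\<xi> (f (-1) 0) = -1" and right: "\<xi> (f (int n) 0) = -1"
    and short: "h * real n \<le> 2"
  shows "flip_reach L h (ising L h \<xi> + 4) \<xi> (set_row \<xi> (\<lambda>k. f (int k) 0) (-1) n) \<and>
     ising L h (set_row \<xi> (\<lambda>k. f (int k) 0) (-1) n) \<le> ising L h \<xi>"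
proof -
  let ?r = "\<lambda>k. f (int k) 0" let ?g = "set_row \<xi> ?r (-1)"
  have rt: "?r k \<in> torus L" for k
    using frame_torus[OF f] .
  have gm: "?g m \<in> configs L" for m
    using set_row_configs[OF x, of ?r "-1" m] rt by simp
  have sp: "?g m (f s t) = -1 \<or> ?g m (f s t) = 1" for m s t
    using spin_cases[OF gm frame_torus[OF f]] .
  have down: "?g m i = -1" if "\<xi> i = -1" for m i
    using that by (simp add: set_row_def)
  have step: "ising L h (?g (Suc m)) = ising L h (?g m) + 2 * (nbr_sum L (?g m) (?r m) + h)"
    if "m < n" for m
    unfolding set_row_Suc
    using ising_flip[OF rt, of "?g m" m "-1" h] set_row_new[OF frame_row_inj[OF f, of 0], of m \<xi> "-1"]
      row[OF that] that n by simp
  have S: "nbr_sum L (?g m) (?r m) = real_of_int (?g m (f (int m + 1) 0)) +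
      real_of_int (?g m (f (int m - 1) 0)) + real_of_int (?g m (f (int m) 1)) + real_of_int (?g m (f (int m) (-1)))"
    for m
    using frame_nbr_sum[OF f L, of "?g m" "int m" 0] by simp
  have lft: "?g m (f (int m - 1) 0) = -1" for m
  proof (cases m)
    case 0
    then show ?thesis using down[OF left] by simp
  next
    case (Suc k)
    then show ?thesis by (simp add: set_row_def)
  qed
  have E: "ising L h (?g m) \<le> ising L h \<xi> + 2 * h * real m" if "m \<le> n" for m
    using that
  proof (induction m)
    case 0
    then show ?case by (simp add: set_row_0)
  next
    case (Suc m)
    have "nbr_sum L (?g m) (?r m) \<le> 0"
      unfolding S using down[OF above, of m m] lft[of m] Suc.prems sp[of m "int m + 1" 0]
        sp[of m "int m" "-1"] by auto
    then show ?case
      using step[of m] Suc by (simp add: algebra_simps)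
  qed
  have "ising L h (?g k) \<le> ising L h \<xi> + 4" if "k \<le> n" for k
  proof -
    have "h * real k \<le> h * real n"
      using that h by simp
    then show ?thesis
      using E[OF that] short by linarith
  qed
  then have reach: "flip_reach L h (ising L h \<xi> + 4) \<xi> (?g n)"
    by (intro flip_reach_set_row[OF x rt]) auto
  obtain m where m: "n = Suc m"
    using n by (cases n) auto
  have "?g m (f (int m + 1) 0) = -1"
    using down[OF right, of m] m by (simp add: add.commute)
  then have "nbr_sum L (?g m) (?r m) \<le> -2"
    unfolding S using down[OF above, of m m] lft[of m] m sp[of m "int m" "-1"] by auto
  then have "ising L h (?g n) \<le> ising L h \<xi>"
    using step[of m] E[of m] m short by (simp add: algebra_simps)
  with reach show ?thesis by blast
qed

section \<open>Descent from a nonconstant Ising configuration\<close>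

lemma flip_step_mono: "c \<le> c' \<Longrightarrow> flip_step L h c \<xi> \<xi>' \<Longrightarrow> flip_step L h c' \<xi> \<xi>'"
  by (auto simp: flip_step_def)

lemma flip_reach_mono: "flip_reach L h c \<xi> \<xi>' \<Longrightarrow> c \<le> c' \<Longrightarrow> flip_reach L h c' \<xi> \<xi>'"
  by (erule rtranclp_mono[THEN predicate2D, rotated]) (auto intro: flip_step_mono)

text \<open>In a local minimum the plus clusters are well-separated rectangles or bands, so a side longer
  than \<open>2 / h\<close> or wrapping around the torus can be advanced, and any other side can be retracted.
  At the critical length \<open>2 / h\<close> retraction may leave the energy unchanged.\<close>

lemma local_min_move:
  assumes L: "3 \<le> L" and x: "\<xi> \<in> configs L" and h: "0 < h" "h < 1"
    and ne: "\<xi> \<noteq> plus_conf L" "\<xi> \<noteq> minus_conf L"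
    and local_min: "\<forall>i\<in>torus L. 0 \<le> real_of_int (\<xi> i) * (nbr_sum L \<xi> i + h)"
  shows "(\<exists>\<xi>'. flip_reach L h (ising L h \<xi> + 4) \<xi> \<xi>' \<and> ising L h \<xi>' < ising L h \<xi>) \<or>
    (\<exists>\<xi>'. flip_reach L h (ising L h \<xi> + 4) \<xi> \<xi>' \<and> ising L h \<xi>' \<le> ising L h \<xi> \<and>
       \<xi>' \<in> configs L \<and> \<xi>' \<noteq> plus_conf L \<and> \<xi>' \<noteq> minus_conf L \<and>
       {i \<in> torus L. \<xi>' i = 1} \<subset> {i \<in> torus L. \<xi> i = 1})"
proof -
  note lm = bspec[OF local_min]
  obtain f0 where f0: "frame L f0" and f0p: "\<xi> (f0 0 0) = 1" and f0m: "\<xi> (f0 0 1) = -1"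
    using boundary_frame[OF _ x ne] L by auto
  \<comment> \<open>The neighbour sum is even and, by local minimality, at most -h, hence at most
    -2. With a plus below, the other three neighbours must be minus.\<close>
  have spread: "\<xi> (f (s + 1) 1) = -1" "\<xi> (f (s - 1) 1) = -1"
    if f: "frame L f" and "\<xi> (f s 0) = 1" "\<xi> (f s 1) = -1" for f s
  proof -
    have "nbr_sum L \<xi> (f s 1) + h \<le> 0"
      using lm[OF frame_torus[OF f], of s 1] that by simp
    then show "\<xi> (f (s + 1) 1) = -1" "\<xi> (f (s - 1) 1) = -1"
      using frame_nbr_sum[OF f L, of \<xi> s 1] that h spin_cases[OF x frame_torus[OF f], of "s+1" 1]
        spin_cases[OF x frame_torus[OF f], of "s-1" 1] spin_cases[OF x frame_torus[OF f], of s 2]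
      by auto
  qed
  have run: "\<xi> (f (int k) 1) = -1"
    if f: "frame L f" and "\<xi> (f 0 1) = -1" and "\<And>j. j < k \<Longrightarrow> \<xi> (f (int j) 0) = 1" for f k
    using that(3)
  proof (induction k)
    case 0
    then show ?case using that by simp
  next
    case (Suc k)
    then show ?case
      using spread(1)[OF f, of "int k"] by (simp add: add.commute)
  qed
  have runl: "\<xi> (f (- int k) 1) = -1"
    if f: "frame L f" and "\<xi> (f 0 1) = -1" and "\<And>j. j < k \<Longrightarrow> \<xi> (f (- int j) 0) = 1" for f k
    using that(3)
  proof (induction k)
    case 0
    then show ?case using that by simp
  next
    case (Suc k)
    have "- int (Suc k) = - int k - 1"
      by simp
    moreover have "\<xi> (f (- int k) 1) = -1" "\<xi> (f (- int k) 0) = 1"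
      using Suc by auto
    ultimately show ?case
      using spread(2)[OF f, of "- int k"] by (simp only:)
  qed
  show ?thesis
  proof (cases "\<forall>k<L. \<xi> (f0 (int k) 0) = 1")
    case True
    then have "\<exists>\<xi>'. flip_reach L h (ising L h \<xi> + 4) \<xi> \<xi>' \<and> ising L h \<xi>' < ising L h \<xi>"
      using grow_row[OF f0 L x h(1), of L] run[OF f0 f0m] L by auto
    then show ?thesis by blast
  next
    case False
    then obtain k0 where k0: "k0 < L" "\<xi> (f0 (int k0) 0) \<noteq> 1" by blast
    \<comment> \<open>\<open>M\<close> is the distance to the nearest minus on the left, which
      exists by going round the torus. The plus run therefore starts at offset \<open>- M'\<close>,
      with \<open>M' = M - 1\<close>, and \<open>f\<close> takes that site as origin.\<close>
    let ?P = "\<lambda>m. \<xi> (f0 (- int m) 0) \<noteq> 1"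
    have "f0 (- int (L - k0)) 0 = f0 (int k0) 0"
      using frame_period[OF f0, of "- int (L - k0)" 0] k0 by (simp add: of_nat_diff)
    then have P: "?P (L - k0)" using k0 by simp
    define M where "M = (LEAST m. ?P m)"
    have PM: "?P M" and Ml: "\<And>m. m < M \<Longrightarrow> \<not> ?P m"
      unfolding M_def using P by (rule LeastI, blast dest: not_less_Least)
    have "M \<noteq> 0" using PM f0p by (metis neg_0_equal_iff_equal of_nat_0)
    then obtain M' where M': "M = Suc M'" by (cases M) auto
    define f where "f = (\<lambda>s t. f0 (s + (- int M')) (t + 0))"
    have f: "frame L f"
      unfolding f_def by (rule frame_shift[OF f0])
    have sp: "\<xi> (f s t) = -1 \<or> \<xi> (f s t) = 1" for s t
      using spin_cases[OF x frame_torus[OF f]] .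
    have p: "\<xi> (f 0 0) = 1"
      using Ml[of M'] M' by (simp add: f_def)
    have u: "\<xi> (f 0 1) = -1"
      using runl[OF f0 f0m, of M'] Ml M' by (simp add: f_def)
    have "\<xi> (f (-1) 0) \<noteq> 1"
      using PM M' by (simp add: f_def)
    then have l: "\<xi> (f (-1) 0) = -1" using sp by blast
    let ?Q = "\<lambda>n. \<xi> (f (int n) 0) \<noteq> 1"
    \<comment> \<open>The site at \<open>L - 1\<close> is the minus at \<open>-1\<close>, so the run
      length \<open>n\<close> is strictly below \<open>L\<close>.\<close>
    have "f (int (L - 1)) 0 = f (-1) 0"
      using frame_period[OF f, of "-1" 0] L by (simp add: of_nat_diff)
    then have Q: "?Q (L - 1)" using l by simp
    define n where "n = (LEAST n. ?Q n)"
    have Qn: "?Q n" and nl: "\<And>k. k < n \<Longrightarrow> \<xi> (f (int k) 0) = 1"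
      unfolding n_def using Q by (rule LeastI, blast dest: not_less_Least)
    have nL: "n < L" using Least_le[of ?Q, OF Q] L unfolding n_def by linarith
    have n0: "0 < n" using Qn p by (metis gr0I of_nat_0)
    have r: "\<xi> (f (int n) 0) = -1" using Qn sp by blast
    have a: "\<xi> (f (int k) 1) = -1" if "k < n" for k
      using run[OF f u, of k] nl that by simp
    show ?thesis
    proof (cases "2 < h * real n")
      case True
      then show ?thesis
        using grow_row[OF f L x h(1), of n] nL n0 nl a by simp
    next
      case False
      let ?g = "set_row \<xi> (\<lambda>k. f (int k) 0) (-1) n"
      have R: "flip_reach L h (ising L h \<xi> + 4) \<xi> ?g" "ising L h ?g \<le> ising L h \<xi>"
        using shrink_row[OF f L x h(1) nL n0 nl a l r] False by auto
      have gc: "?g \<in> configs L"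
        by (rule set_row_configs[OF x frame_torus[OF f]]) simp
      have gl: "?g (f 0 0) = -1"
        using n0 by (force simp: set_row_def)
      have "?g \<noteq> plus_conf L"
        using gl frame_torus[OF f, of 0 0] by (auto simp: plus_conf_def)
      moreover have "?g \<noteq> minus_conf L"
      proof -
        \<comment> \<open>As \<open>h < 1\<close>, the even neighbour sum at this plus corner is at
          least 0. The spins to its left and above are minus, so the one below is plus, and it
          survives the retraction.\<close>
        have "0 \<le> nbr_sum L \<xi> (f 0 0) + h"
          using lm[OF frame_torus[OF f], of 0 0] p by simp
        then have b: "\<xi> (f 0 (-1)) = 1"
          using frame_nbr_sum[OF f L, of \<xi> 0 0] l u h sp[of 1 0] sp[of 0 "-1"] by auto
        have "\<not> int L dvd 1"
          using L by auto
        then have "f 0 (-1) \<noteq> f (int k) 0" for k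
          using f by (auto simp: frame_def mod_eq_dvd_iff)
        then have "?g (f 0 (-1)) = 1"
          using b by (auto simp: set_row_def)
        then show ?thesis
          using frame_torus[OF f, of 0 "-1"] by (auto simp: minus_conf_def)
      qed
      moreover have "{i \<in> torus L. ?g i = 1} \<subset> {i \<in> torus L. \<xi> i = 1}"
        using gl p frame_torus[OF f, of 0 0] by (auto simp: set_row_def split: if_splits)
      ultimately show ?thesis
        using R gc by blast
    qed
  qed
qed

text \<open>A retraction may leave the energy unchanged, but it removes plus sites; induction on
  their number thus ends in a strict decrease. The barrier does not accumulate, because each round
  starts no higher than the previous one.\<close>

lemma ising_descent:
  assumes L: "2 \<le> L" and h: "0 < h" "h < 1"
    and x: "\<xi> \<in> configs L" and ne: "\<xi> \<noteq> plus_conf L" "\<xi> \<noteq> minus_conf L"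
  shows "\<exists>\<xi>'. flip_reach L h (ising L h \<xi> + 4) \<xi> \<xi>' \<and> \<xi>' \<in> configs L \<and> ising L h \<xi>' < ising L h \<xi>"
  using x ne
proof (induction "card {i \<in> torus L. \<xi> i = 1}" arbitrary: \<xi> rule: less_induct)
  case less
  note x = less.prems(1) and ne = less.prems(2,3)
  have cf: "\<xi>' \<in> configs L" if "flip_reach L h c \<xi> \<xi>'" for \<xi>' c
    using that by (induction rule: rtranclp_induct)
      (use x configs_upd in \<open>auto simp: flip_step_def\<close>)
  show ?case
  proof (cases "\<exists>i\<in>torus L. real_of_int (\<xi> i) * (nbr_sum L \<xi> i + h) < 0")
    case True
    then obtain i where i: "i \<in> torus L" "real_of_int (\<xi> i) * (nbr_sum L \<xi> i + h) < 0" by blast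
    let ?y = "\<xi>(i := - \<xi> i)"
    have "ising L h ?y < ising L h \<xi>"
      using ising_flip[OF i(1), of \<xi> "- \<xi> i" h] i(2) by simp
    moreover have "flip_step L h (ising L h \<xi> + 4) \<xi> ?y"
      unfolding flip_step_def using calculation i(1) x spin_cases[OF x i(1)] by auto
    ultimately show ?thesis
      using cf by blast
  next
    case False
    then have local_min: "\<forall>i\<in>torus L. 0 \<le> real_of_int (\<xi> i) * (nbr_sum L \<xi> i + h)"
      by (auto simp: not_less)
    note lm = bspec[OF local_min]
    \<comment> \<open>For \<open>L = 2\<close> a site has only two neighbours, so a minus next to a
      plus has neighbour sum at least 0 and its flip lowers the energy, against local
      minimality.\<close>
    have "3 \<le> L"
    proof (rule ccontr)
      assume "\<not> 3 \<le> L"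
      with L have L2: "L = 2" by simp
      obtain f where f: "frame L f" "\<xi> (f 0 0) = 1" "\<xi> (f 0 1) = -1"
        using boundary_frame[OF L x ne] by blast
      have "f (-1) 1 = f 1 1" "f 0 2 = f 0 0" "f 1 1 \<noteq> f 0 0"
        using f(1) L2 by (auto simp: frame_def)
      then have "nbrs L (f 0 1) = {f 1 1, f 0 0}"
        using f(1) by (auto simp: frame_def)
      then have "nbr_sum L \<xi> (f 0 1) = real_of_int (\<xi> (f 1 1)) + 1"
        using \<open>f 1 1 \<noteq> f 0 0\<close> f(2) by (simp add: nbr_sum_nbrs)
      then show False
        using lm[OF frame_torus[OF f(1)], of 0 1] f h
          spin_cases[OF x frame_torus[OF f(1)], of 1 1] by auto
    qed
    from local_min_move[OF this x h ne local_min] show ?thesis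
    proof (elim disjE exE conjE)
      fix y assume y: "flip_reach L h (ising L h \<xi> + 4) \<xi> y" "ising L h y \<le> ising L h \<xi>"
        "y \<in> configs L" "y \<noteq> plus_conf L" "y \<noteq> minus_conf L"
        "{i \<in> torus L. y i = 1} \<subset> {i \<in> torus L. \<xi> i = 1}"
      have "card {i \<in> torus L. y i = 1} < card {i \<in> torus L. \<xi> i = 1}"
        using y(6) finite_torus by (intro psubset_card_mono) auto
      from less.hyps[OF this y(3-5)] obtain z where z: "flip_reach L h (ising L h y + 4) y z"
        "z \<in> configs L" "ising L h z < ising L h y" by blast
      have "flip_reach L h (ising L h \<xi> + 4) y z"
        using flip_reach_mono[OF z(1)] y(2) by simp
      then show ?thesis
        using y(1,2) z(2,3) by (meson less_le_trans rtranclp_trans)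
    qed (use cf in blast)
  qed
qed

section \<open>Comparison with the critical barrier, and conclusion\<close>

lemma Gamma_PCA_gt_4:
  assumes "0 < h" "h < 1"
  shows "4 < Gamma_PCA h"
proof -
  define l where "l = real_of_int (crit_length h)"
  have l: "2 / h < l" "l \<le> 2 / h + 1"
    unfolding l_def crit_length_def by linarith+
  have "2 < 2 / h"
    using assms by (simp add: field_simps)
  then have "2 < l"
    using l(1) by linarith
  moreover have "h * l \<le> 2 + h"
    using l(2) assms by (simp add: field_simps)
  \<comment> \<open>Both factors are at least 2. Twice this product is \<Gamma> + 2h, so \<Gamma> is
    at least 8 - 2h.\<close>
  ultimately have "2 * 2 \<le> l * (4 + h - h * l)"
    by (intro mult_mono) auto
  then have "4 * 2 \<le> 2 * l * (4 + h - h * l)"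
    by simp
  also have "\<dots> = Gamma_PCA h + 2 * h"
    unfolding Gamma_PCA_def l_def[symmetric] by (simp add: algebra_simps power2_eq_square)
  finally show ?thesis
    using assms by linarith
qed

theorem lemma3p1:
  shows "\<exists>h0::real. 0 < h0 \<and> h0 \<le> 1 \<and>
    (\<forall>h::real. 0 < h \<and> h < h0 \<longrightarrow>
      (\<forall>L::nat. 0 < L \<and> even L \<longrightarrow>
        (\<forall>\<eta> \<in> configs L - {minus_conf L, chess_even L, chess_odd L, plus_conf L}.
          \<exists>Vstar::real. stability_level L h \<eta> \<le> ereal Vstar \<and> Vstar < Gamma_PCA h)))"
proof (rule exI[of _ "1::real"], intro conjI allI impI ballI)
  fix h :: real and L :: nat and \<eta>
  assume hh: "0 < h \<and> h < 1" and LL: "0 < L \<and> even L"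
    and eta: "\<eta> \<in> configs L - {minus_conf L, chess_even L, chess_odd L, plus_conf L}"
  have h: "0 < h" "h < 1" and L: "even L" "2 \<le> L"
    using hh LL by (auto elim!: evenE)
  have e: "\<eta> \<in> configs L"
    using eta by blast
  \<comment> \<open>Pairing \<eta> with its zero-temperature image makes the sum of the two Ising
    energies exactly the virtual energy of \<eta>.\<close>
  define T where "T = zero_temp L h \<eta>"
  define \<xi> where "\<xi> = mix \<eta> T"
  define \<zeta> where "\<zeta> = mix T \<eta>"
  have T: "T \<in> configs L"
    unfolding T_def by (rule zero_temp_configs)
  have x: "\<xi> \<in> configs L" and z: "\<zeta> \<in> configs L"
    unfolding \<xi>_def \<zeta>_def using e T by (auto intro: mix_configs)
  have eta_mix: "\<eta> = mix \<xi> \<zeta>"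
    unfolding \<xi>_def \<zeta>_def by (simp add: mix_mix)
  have H: "energy L h \<eta> = ising L h \<xi> + ising L h \<zeta>"
    using trans_energy_zero_temp[of L h \<eta>] trans_energy_mix[OF T L(1), of h \<eta>]
    by (simp add: T_def \<xi>_def \<zeta>_def)
  \<comment> \<open>An inequality suffices for the endpoint: its virtual energy is at most that of
    any outgoing transition, so lowering one Ising energy brings it below that of \<eta>.\<close>
  have low: "energy L h (mix \<alpha> \<gamma>) \<le> ising L h \<alpha> + ising L h \<gamma>"
    if "\<alpha> \<in> configs L" "\<gamma> \<in> configs L" for \<alpha> \<gamma>
    using energy_le_trans_energy[OF mix_configs[OF that(2,1)], of h "mix \<alpha> \<gamma>"]
      trans_energy_mix_swap[OF that L(1), of h] by simp
  let ?U = "{plus_conf L, minus_conf L}"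
  have uniform: "mix (plus_conf L) (plus_conf L) = plus_conf L"
    "mix (minus_conf L) (minus_conf L) = minus_conf L"
    "mix (plus_conf L) (minus_conf L) = chess_even L"
    "mix (minus_conf L) (plus_conf L) = chess_odd L"
    by (auto simp: mix_def plus_conf_def minus_conf_def chess_even_def chess_odd_def fun_eq_iff)
  \<comment> \<open>The four pairs of constant configurations mix exactly to the four excluded
    configurations.\<close>
  have "\<xi> \<notin> ?U \<or> \<zeta> \<notin> ?U"
    using eta eta_mix uniform by auto
  then have "\<exists>\<theta>. (pca_step L h (energy L h \<eta> + 4))\<^sup>*\<^sup>* \<eta> \<theta> \<and> \<theta> \<in> configs L \<and> energy L h \<theta> < energy L h \<eta>"
  proof
    assume "\<xi> \<notin> ?U"
    then obtain y where y: "flip_reach L h (ising L h \<xi> + 4) \<xi> y" "y \<in> configs L"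
      "ising L h y < ising L h \<xi>"
      using ising_descent[OF L(2) h x] by auto
    show ?thesis
      using flip_reach_pca(1)[OF y(1) z L(1)] mix_configs[OF y(2) z] low[OF y(2) z] y(3)
      by (intro exI[of _ "mix y \<zeta>"]) (simp add: H eta_mix[symmetric] add_ac)
  next
    assume "\<zeta> \<notin> ?U"
    then obtain y where y: "flip_reach L h (ising L h \<zeta> + 4) \<zeta> y" "y \<in> configs L"
      "ising L h y < ising L h \<zeta>"
      using ising_descent[OF L(2) h z] by auto
    show ?thesis
      using flip_reach_pca(2)[OF y(1) x L(1)] mix_configs[OF x y(2)] low[OF x y(2)] y(3)
      by (intro exI[of _ "mix \<xi> y"]) (simp add: H eta_mix[symmetric] add_ac)
  qed
  then obtain \<theta> where t: "(pca_step L h (energy L h \<eta> + 4))\<^sup>*\<^sup>* \<eta> \<theta>" "\<theta> \<in> configs L"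
    "energy L h \<theta> < energy L h \<eta>" by blast
  show "\<exists>Vstar::real. stability_level L h \<eta> \<le> ereal Vstar \<and> Vstar < Gamma_PCA h"
    \<comment> \<open>The bound 4 is the Ising barrier, uniform in \<open>h\<close>,
      \<open>L\<close> and \<eta>.\<close>
    using stability_level_le[OF t(1) e t(2,3)] Gamma_PCA_gt_4[OF h] by (intro exI[of _ 4]) simp
qed auto

end
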